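(* For $n\ge1$ let $s(n)=\sum_{w\in\mathcal{M}_n}\mathrm{sper}(w)$ be the total semiperimeter over all Motzkin polyominoes of length $n$. Then $$\sum_{n\ge1}s(n)x^n=\frac{1 + x^2-(1+x)\sqrt{1 - 2 x - 3 x^2}}{2x\sqrt{1 - 2 x - 3 x^2}},$$ and, as $n\to\infty$, $$s(n)\sim\frac{5 \sqrt{3}\, \sqrt{\frac{1}{n}}\; 3^n}{6 \sqrt{\pi}}.$$
   Context: A Motzkin word of length $n\ge 1$ is a word $w=w_1\cdots w_n$ over the positive integers such that $w_1=1$, and $1\le w_k\le w_{k-1}+1$ and $w_{k-1}\ne w_k$ for $k=2,\dots,n$; $\mathcal{M}_n$ is the set of Motzkin words of length $n$. To $w$ one associates the Motzkin polyomino $P(w)$ of length $n$ with $n$ columns, all bottom-justified, whose $i$-th column consists of $w_i$ unit cells. The perimeter of $P(w)$ is the number of (unit) cell borders that do not touch another cell of $P(w)$, and the semiperimeter $\mathrm{sper}(w)$ is half of the perimeter. *)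

theory Defs
  imports
    "HOL-Computational_Algebra.Computational_Algebra"
    "HOL-Library.Landau_Symbols"
    Complex_Main
begin

text \<open>
  Words are lists over the naturals; since lists are indexed from 0, the letter \<open>w\<^sub>k\<close> is
  \<open>w ! (k - 1)\<close>.
\<close>

definition motzkin_words :: "nat \<Rightarrow> nat list set" where
  "motzkin_words n = {w. length w = n \<and> n \<ge> 1 \<and> w ! 0 = 1 \<and>
     (\<forall>k. 1 \<le> k \<and> k < n \<longrightarrow>
        1 \<le> w ! k \<and> w ! k \<le> w ! (k - 1) + 1 \<and> w ! (k - 1) \<noteq> w ! k)}"

text \<open>
  The pair \<open>(i, j)\<close> stands for the unit cell \<open>[i, i + 1] \<times> [j, j + 1]\<close>. Integer coordinates are
  used so that the positions to the left of and below the polyomino exist as well.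
\<close>

type_synonym cell = "int \<times> int"

definition polyomino :: "nat list \<Rightarrow> cell set" where
  "polyomino w = {(int i, int j) |i j. i < length w \<and> j < w ! i}"

definition neighbours :: "cell \<Rightarrow> cell set" where
  "neighbours c = (case c of (i, j) \<Rightarrow> {(i + 1, j), (i - 1, j), (i, j + 1), (i, j - 1)})"

text \<open>
  A border of a cell \<open>c\<close> is represented by the pair of \<open>c\<close> and the position \<open>d\<close> on the other side
  of it. It touches another cell of the polyomino \<open>P\<close> iff \<open>d \<in> P\<close>, so every border that does not
  is counted exactly once.
\<close>

definition perimeter :: "cell set \<Rightarrow> nat" where
  "perimeter P = card {(c, d). c \<in> P \<and> d \<in> neighbours c \<and> d \<notin> P}"

definition sper :: "nat list \<Rightarrow> real" where
  "sper w = real (perimeter (polyomino w)) / 2"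

definition total_sper :: "nat \<Rightarrow> real" where
  "total_sper n = (\<Sum>w\<in>motzkin_words n. sper w)"

text \<open>
  The square root of a formal power series with constant term 1 that has constant term 1
  itself. Generating functions are embedded into formal Laurent series, which form a
  field, so that dividing by \<open>2x\<close> is exact.
\<close>

definition fps_sqrt :: "real fps \<Rightarrow> real fps" where
  "fps_sqrt f = fps_radical root 2 f"

end

theory Submission
  imports
    Defs
    "HOL-Analysis.Gamma_Function"
    "HOL-Analysis.Generalised_Binomial_Theorem"
    "HOL-Real_Asymp.Real_Asymp"
begin

text \<open>
  Every column of the polyomino has exposed borders at its top and at its bottom, and the
  exposed vertical borders are the rises and the falls of the height profile, which starts and
  ends at height 0. Total rise equals total fall, so the semiperimeter is the length of the word
  plus its total rise (\<open>perimeter_polyomino\<close>).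

  A Motzkin word is cut at the second occurrence of the letter 1: it is \<open>1\<close>, or \<open>1 u\<^sup>+\<close>, or
  \<open>1 u\<^sup>+ v\<close>, with Motzkin words \<open>u\<close> and \<open>v\<close> and with \<open>u\<^sup>+\<close> obtained from \<open>u\<close> by raising every letter by 1
  (\<open>motzkin_words_Suc\<close>). The semiperimeters in the three cases are \<open>2\<close>, \<open>sper u + 2\<close> and
  \<open>sper u + sper v + 1\<close>. For the generating functions \<open>M\<close> of the number of words and \<open>S\<close> of the
  total semiperimeter this means \<open>M = x (1 + M + M\<^sup>2)\<close> and
  \<open>S = x (2 + S + 2 M + 2 M S + M\<^sup>2)\<close>. The first equation says that \<open>1 - x - 2 x M\<close> is the square
  root \<open>R\<close> of \<open>1 - 2 x - 3 x\<^sup>2\<close>; the second is linear in \<open>S\<close> with leading coefficient \<open>R\<close>,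
  and solving it gives the closed form (\<open>sper_fps_root_fps\<close>).

  For the asymptotics, multiplying the closed form by \<open>2 x\<close> gives
  \<open>2 x S = (1 + x\<^sup>2) / R - (1 + x)\<close>, so \<open>2 s(n) = c(n + 1) + c(n - 1)\<close> where \<open>c(n)\<close> are the
  coefficients of \<open>1 / R = (1 + x)\<^bsup>-1/2\<^esup> (1 - 3 x)\<^bsup>-1/2\<^esup>\<close>, the central trinomial coefficients.
  The factor \<open>(1 - 3 x)\<^bsup>-1/2\<^esup>\<close> has coefficients asymptotic to \<open>3\<^bsup>n\<^esup> / sqrt (\<pi> n)\<close>, and Tannery's
  theorem shows that the other factor contributes its value \<open>sqrt 3 / 2\<close> at the dominant
  singularity \<open>x = 1 / 3\<close> (\<open>trinomial_limit\<close>).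
\<close>

unbundle no vec_syntax

section \<open>The semiperimeter as length plus total rise\<close>

text \<open>
  The first argument is the height from which the profile enters the word. Subtraction truncates,
  so only the steps upwards contribute.
\<close>

fun rise :: "nat \<Rightarrow> nat list \<Rightarrow> nat" where
  "rise a [] = 0"
| "rise a (x # xs) = (x - a) + rise x xs"

text \<open>
  In contrast to \<open>rise\<close>, the final descent to height 0 is included.
\<close>

fun fall :: "nat \<Rightarrow> nat list \<Rightarrow> nat" where
  "fall a [] = a"
| "fall a (x # xs) = (a - x) + fall x xs"

lemma fall_eq_rise: "fall a w = a + rise a w"
  by (induction w arbitrary: a) auto

lemma rise_eq_sum: "rise a w = (\<Sum>i<length w. w ! i - (a # w) ! i)"
  by (induction w arbitrary: a) (auto simp: sum.lessThan_Suc_shift simp del: sum.lessThan_Suc)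

lemma fall_eq_sum: "fall a w = (\<Sum>i<Suc (length w). (a # w) ! i - (w @ [0]) ! i)"
  by (induction w arbitrary: a) (auto simp: sum.lessThan_Suc_shift simp del: sum.lessThan_Suc)

lemma mem_polyomino_iff:
  "(a, b) \<in> polyomino w \<longleftrightarrow> 0 \<le> a \<and> 0 \<le> b \<and> nat a < length w \<and> nat b < w ! nat a"
  unfolding polyomino_def by (force intro: exI[of _ "nat a"] exI[of _ "nat b"])

text \<open>
  The exposed borders in direction \<open>(d, e)\<close> can be counted column by column.
\<close>

lemma card_borders:
  fixes d e :: int
  defines "A \<equiv> \<lambda>w i. {j. j < w ! i \<and> (int i + d, int j + e) \<notin> polyomino w}"
  defines "B \<equiv> \<lambda>w. {((i, j), (i + d, j + e)) |i j.
             (i, j) \<in> polyomino w \<and> (i + d, j + e) \<notin> polyomino w}"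
  shows "card (B w) = (\<Sum>i<length w. card (A w i))" and "finite (B w)"
proof -
  let ?f = "\<lambda>(i, j). ((int i, int j), (int i + d, int j + e))"
  have eq: "B w = ?f ` (SIGMA i:{..<length w}. A w i)"
    unfolding A_def B_def by (auto simp: polyomino_def)
  have fin: "finite (A w i)" for i
    by (auto simp: A_def)
  have "inj_on ?f (SIGMA i:{..<length w}. A w i)"
    by (auto simp: inj_on_def)
  thus "card (B w) = (\<Sum>i<length w. card (A w i))"
    using fin unfolding eq by (simp add: card_image)
  show "finite (B w)" using fin unfolding eq by auto
qed

text \<open>
  The exposed borders are counted by their direction. Each column contributes one top and one
  bottom border, since it is not empty. The exposed left borders of a column belong to the cells
  that stick out above its predecessor, so they add up to the total rise, and likewise the right
  borders add up to the total fall. The profile starts and ends at height 0, so total rise and total fall agree.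
\<close>

lemma perimeter_polyomino:
  assumes pos: "\<forall>x\<in>set w. x \<ge> 1"
  shows "perimeter (polyomino w) = 2 * (length w + rise 0 w)"
proof -
  define n where "n = length w"
  define P where "P = polyomino w"
  define B where "B = (\<lambda>d e. {((i, j), (i + d, j + e)) |i j. (i, j) \<in> P \<and> (i + d, j + e) \<notin> P})"
  have pos': "w ! i \<ge> 1" if "i < n" for i
    using that pos by (auto simp: n_def)
  have card_B: "card (B d e) = (\<Sum>i<n. card {j. j < w ! i \<and> (int i + d, int j + e) \<notin> P})"
    and fin_B: "finite (B d e)" for d e
    using card_borders[of d e w] by (simp_all add: B_def P_def n_def)
  have split: "{(c, d). c \<in> P \<and> d \<in> neighbours c \<and> d \<notin> P} =
      B 0 1 \<union> B 0 (-1) \<union> B (-1) 0 \<union> B 1 0"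
    by (auto simp: neighbours_def B_def)
  have top: "{j. j < w ! i \<and> (int i + 0, int j + 1) \<notin> P} = {w ! i - 1}" if "i < n" for i
    using pos'[OF that] that by (auto simp: P_def mem_polyomino_iff nat_add_distrib n_def)
  have bot: "{j. j < w ! i \<and> (int i + 0, int j + (-1)) \<notin> P} = {0}" if "i < n" for i
    using pos'[OF that] that by (auto simp: P_def mem_polyomino_iff nat_diff_distrib' n_def)
  have left: "{j. j < w ! i \<and> (int i + (-1), int j + 0) \<notin> P} = {(0 # w) ! i..<w ! i}" if "i < n" for i
    using that by (cases i) (auto simp: P_def mem_polyomino_iff n_def)
  have right: "{j. j < w ! i \<and> (int i + 1, int j + 0) \<notin> P} = {(w @ [0]) ! Suc i..<w ! i}" if "i < n" for i
    using that by (cases "Suc i < n") (auto simp: P_def mem_polyomino_iff n_def nth_append nat_add_distrib)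
  have "perimeter P = card (B 0 1) + card (B 0 (-1)) + card (B (-1) 0) + card (B 1 0)"
  proof -
    have "B 0 1 \<inter> B 0 (-1) = {}" "(B 0 1 \<union> B 0 (-1)) \<inter> B (-1) 0 = {}"
      "(B 0 1 \<union> B 0 (-1) \<union> B (-1) 0) \<inter> B 1 0 = {}"
      by (auto simp: B_def)
    thus ?thesis
      unfolding perimeter_def split using fin_B by (simp add: card_Un_disjoint)
  qed
  also have "card (B 0 1) = n" unfolding card_B using top by simp
  also have "card (B 0 (-1)) = n" unfolding card_B using bot by simp
  also have "card (B (-1) 0) = rise 0 w"
    unfolding card_B using left by (simp add: rise_eq_sum n_def)
  also have "card (B 1 0) = rise 0 w"
    unfolding card_B using right fall_eq_sum[of 0 w] fall_eq_rise[of 0 w]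
    by (simp add: n_def sum.lessThan_Suc_shift del: sum.lessThan_Suc)
  finally show ?thesis by (simp add: P_def n_def)
qed

section \<open>First-return decomposition\<close>

text \<open>
  Unlike the description by indices, this form behaves well under appending and mapping.
\<close>

definition motzkin :: "nat list \<Rightarrow> bool" where
  "motzkin w \<longleftrightarrow> w \<noteq> [] \<and> hd w = 1 \<and> successively (\<lambda>a b. 1 \<le> b \<and> b \<le> a + 1 \<and> a \<noteq> b) w"

lemma motzkin_words_eq: "motzkin_words n = {w. motzkin w \<and> length w = n}"
proof (intro set_eqI iffI)
  fix w assume "w \<in> motzkin_words n"
  hence *: "length w = n" "n \<ge> 1" "w ! 0 = 1"
    "\<And>k. 1 \<le> k \<Longrightarrow> k < n \<Longrightarrow> 1 \<le> w ! k \<and> w ! k \<le> w ! (k - 1) + 1 \<and> w ! (k - 1) \<noteq> w ! k"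
    by (auto simp: motzkin_words_def)
  have "successively (\<lambda>a b. 1 \<le> b \<and> b \<le> a + 1 \<and> a \<noteq> b) w"
    unfolding successively_conv_nth using *(4)[of "Suc _"] *(1) by auto
  moreover have "w \<noteq> []" using * by auto
  ultimately show "w \<in> {w. motzkin w \<and> length w = n}"
    using * by (simp add: motzkin_def hd_conv_nth)
next
  fix w assume "w \<in> {w. motzkin w \<and> length w = n}"
  hence *: "length w = n" "w \<noteq> []" "w ! 0 = 1"
    "\<And>i. Suc i < length w \<Longrightarrow> 1 \<le> w ! Suc i \<and> w ! Suc i \<le> w ! i + 1 \<and> w ! i \<noteq> w ! Suc i"
    by (auto simp: motzkin_def hd_conv_nth successively_conv_nth)
  have "1 \<le> w ! k \<and> w ! k \<le> w ! (k - 1) + 1 \<and> w ! (k - 1) \<noteq> w ! k" if "1 \<le> k" "k < n" for k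
    using *(4)[of "k - 1"] that *(1) by auto
  with * show "w \<in> motzkin_words n"
    by (auto simp: motzkin_words_def Suc_le_eq)
qed

lemma motzkin_pos:
  assumes "motzkin w" "x \<in> set w"
  shows "x \<ge> 1"
proof -
  obtain k where k: "k < length w" "x = w ! k"
    using assms(2) by (auto simp: in_set_conv_nth)
  show ?thesis
  proof (cases k)
    case 0
    thus ?thesis using assms(1) k by (cases w) (auto simp: motzkin_def)
  next
    case (Suc i)
    thus ?thesis using assms(1) k by (auto simp: motzkin_def dest: successively_nth)
  qed
qed

lemma motzkin_lift:
  assumes "motzkin u"
  shows "motzkin (1 # map Suc u)"
proof -
  have "successively (\<lambda>a b. 1 \<le> Suc b \<and> Suc b \<le> Suc a + 1 \<and> Suc a \<noteq> Suc b) u"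
    by (rule successively_mono[of "\<lambda>a b. 1 \<le> b \<and> b \<le> a + 1 \<and> a \<noteq> b"])
      (use assms in \<open>auto simp: motzkin_def\<close>)
  thus ?thesis
    using assms by (simp add: motzkin_def successively_Cons successively_map hd_map)
qed

lemma motzkin_lift_append:
  assumes "motzkin u" "motzkin v"
  shows "motzkin (1 # map Suc u @ v)"
proof -
  let ?u = "1 # map Suc u"
  have "u \<noteq> []" using assms by (simp add: motzkin_def)
  hence "last ?u = Suc (last u)" "last u \<ge> 1"
    using motzkin_pos[OF assms(1)] by (simp_all add: last_map)
  moreover have "motzkin ?u" using assms(1) by (rule motzkin_lift)
  ultimately have "motzkin (?u @ v)"
    using assms(2) unfolding motzkin_def successively_append_iff by simp
  thus ?thesis by simp
qed

text \<open>
  After the initial 1, the longest run of letters above 1 is a raised Motzkin word: the letter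
  after the initial 1 differs from 1, so it is 2. What follows the run, if anything, starts with
  the next letter 1.
\<close>

lemma motzkin_cases:
  assumes "motzkin w"
  obtains "w = [1]"
  | u where "motzkin u" "w = 1 # map Suc u"
  | u v where "motzkin u" "motzkin v" "w = 1 # map Suc u @ v"
proof -
  let ?P = "\<lambda>a b. 1 \<le> b \<and> b \<le> a + 1 \<and> a \<noteq> (b::nat)"
  obtain t where w: "w = 1 # t"
    using assms by (cases w) (auto simp: motzkin_def)
  define y where "y = takeWhile (\<lambda>x. x > 1) t"
  define v where "v = dropWhile (\<lambda>x. x > 1) t"
  define u where "u = map (\<lambda>x. x - 1) y"
  have t: "t = y @ v" by (simp add: y_def v_def)
  have y_gt: "\<forall>x\<in>set y. x > 1" by (auto simp: y_def dest: set_takeWhileD)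
  hence y: "y = map Suc u" by (auto simp: u_def o_def intro!: map_idI[symmetric])
  have u_pos: "\<And>x. x \<in> set u \<Longrightarrow> 1 \<le> x" using y_gt by (auto simp: u_def)
  have succ: "successively ?P (1 # y @ v)" using assms by (simp add: motzkin_def w t)
  have v: "motzkin v" if "v \<noteq> []"
  proof -
    have "\<not> hd v > 1" using that unfolding v_def by (rule hd_dropWhile)
    moreover have "hd v \<ge> 1" using motzkin_pos[OF assms, of "hd v"] that by (simp add: w t)
    ultimately have "hd v = 1" by simp
    moreover have "successively ?P v"
      using succ successively_append_iff[of ?P "1 # y" v] by simp
    ultimately show ?thesis using that by (simp add: motzkin_def)
  qed
  show thesis
  proof (cases "t = []")
    case True
    thus ?thesis using that(1) w by simp
  next
    case False
    have "?P 1 (hd t)" using succ False by (simp add: t[symmetric] successively_Cons)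
    hence "hd t > 1" by simp
    hence "u \<noteq> []" using False by (cases t) (auto simp: u_def y_def)
    have "successively ?P (1 # map Suc u)"
      using succ successively_append_iff[of ?P "1 # y" v] by (simp add: y)
    hence "?P 1 (Suc (hd u))" and *: "successively (\<lambda>a b. ?P (Suc a) (Suc b)) u"
      using \<open>u \<noteq> []\<close> by (simp_all add: successively_Cons successively_map hd_map)
    hence "hd u = 1" using u_pos[of "hd u"] \<open>u \<noteq> []\<close> by simp
    moreover have "successively ?P u"
      using * by (rule successively_mono) (use u_pos in auto)
    ultimately have "motzkin u" using \<open>u \<noteq> []\<close> by (simp add: motzkin_def)
    thus ?thesis using that(2)[of u] that(3)[of u v] v by (cases "v = []") (auto simp: w t y)
  qed
qed

text \<open>
  The raised word is recovered as the longest prefix of letters above 1, because what follows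
  it is empty or starts with 1. Allowing the empty word for \<open>v\<close> separates the decompositions with
  and without a second part.
\<close>

lemma lift_append_inject:
  assumes "map Suc u @ v = map Suc u' @ v'" "motzkin u" "motzkin u'" "v = [] \<or> motzkin v" "v' = [] \<or> motzkin v'"
  shows "u = u' \<and> v = v'"
proof -
  have *: "takeWhile (\<lambda>x. x > 1) (map Suc u @ v) = map Suc u" if "motzkin u" "v = [] \<or> motzkin v" for u v
    using that motzkin_pos[OF that(1)]
    by (subst takeWhile_append2; cases v) (auto simp: motzkin_def Suc_le_eq)
  have "map Suc u = map Suc u'" using *[of u v] *[of u' v'] assms by simp
  with assms(1) show ?thesis by (auto dest: map_injective)
qed

lemma motzkin_words_0: "motzkin_words 0 = {}"
  by (simp add: motzkin_words_def)

lemma motzkin_words_Suc: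
  "motzkin_words (Suc n) = (if n = 0 then {[1]} else {}) \<union>
     (\<lambda>u. 1 # map Suc u) ` motzkin_words n \<union>
     (\<lambda>(u, v). 1 # map Suc u @ v) ` (\<Union>i\<le>n. motzkin_words i \<times> motzkin_words (n - i))"
  (is "?L = ?R")
proof (intro equalityI subsetI)
  fix w assume "w \<in> ?L"
  hence "motzkin w" and len: "length w = Suc n" by (auto simp: motzkin_words_eq)
  from this(1) show "w \<in> ?R"
  proof (cases rule: motzkin_cases)
    case (3 u v)
    hence "(u, v) \<in> (\<Union>i\<le>n. motzkin_words i \<times> motzkin_words (n - i))"
      using len by (auto simp: motzkin_words_eq intro!: bexI[of _ "length u"])
    with 3 show ?thesis by (intro UnI2) (auto intro!: image_eqI[of _ _ "(u, v)"])
  qed (use len in \<open>auto simp: motzkin_words_eq\<close>)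
next
  fix w assume "w \<in> ?R"
  then consider "n = 0" "w = [1]"
    | u where "w = 1 # map Suc u" "u \<in> motzkin_words n"
    | i u v where "w = 1 # map Suc u @ v" "i \<le> n"
        "u \<in> motzkin_words i" "v \<in> motzkin_words (n - i)"
    by (auto split: if_splits)
  thus "w \<in> ?L"
  proof cases
    case 1
    thus ?thesis by (simp add: motzkin_words_eq motzkin_def)
  next
    case 2
    thus ?thesis using motzkin_lift[of u] by (simp add: motzkin_words_eq)
  next
    case 3
    thus ?thesis using motzkin_lift_append[of u v] by (simp add: motzkin_words_eq)
  qed
qed

lemma finite_motzkin_words [simp]: "finite (motzkin_words n)"
proof (induction n rule: less_induct)
  case (less n)
  show ?case
  proof (cases n)
    case 0
    thus ?thesis by (simp add: motzkin_words_0)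
  next
    case (Suc m)
    have "finite (motzkin_words m)"
      by (rule less) (simp add: Suc)
    moreover have "finite (motzkin_words i \<times> motzkin_words (m - i))" if "i \<le> m" for i
      by (intro finite_cartesian_product less) (use that Suc in auto)
    hence "finite (\<Union>i\<le>m. motzkin_words i \<times> motzkin_words (m - i))"
      by (intro finite_UN_I) auto
    ultimately show ?thesis
      unfolding Suc motzkin_words_Suc by (intro finite_UnI finite_imageI) auto
  qed
qed

text \<open>
  The recursion for an arbitrary weight \<open>f\<close>; it is used for counting (\<open>f = 1\<close>) and for the
  semiperimeter.
\<close>

lemma sum_motzkin_words_Suc:
  fixes f :: "nat list \<Rightarrow> 'a :: comm_monoid_add"
  shows "(\<Sum>w\<in>motzkin_words (Suc n). f w) = (if n = 0 then f [1] else 0) +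
    (\<Sum>u\<in>motzkin_words n. f (1 # map Suc u)) +
    (\<Sum>i\<le>n. \<Sum>u\<in>motzkin_words i. \<Sum>v\<in>motzkin_words (n - i). f (1 # map Suc u @ v))"
proof -
  let ?A = "if n = 0 then {[1]} else {} :: nat list set"
  let ?B = "(\<lambda>u. 1 # map Suc u) ` motzkin_words n"
  let ?D = "\<Union>i\<le>n. motzkin_words i \<times> motzkin_words (n - i)"
  let ?g = "\<lambda>(u, v). 1 # map Suc u @ v"
  have M: "motzkin w" if "w \<in> motzkin_words k" for w k using that by (simp add: motzkin_words_eq)
  have ne: "w \<noteq> []" if "w \<in> motzkin_words k" for w k using M[OF that] by (simp add: motzkin_def)
  have fin: "finite ?D" by (auto simp: finite_motzkin_words)
  have D: "motzkin u \<and> motzkin v" if "(u, v) \<in> ?D" for u v using that M by blast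
  have inj: "inj_on ?g ?D"
  proof (rule inj_onI)
    fix p q assume pq: "p \<in> ?D" "q \<in> ?D" "?g p = ?g q"
    obtain u v u' v' where [simp]: "p = (u, v)" "q = (u', v')" by (cases p, cases q)
    show "p = q" using lift_append_inject[of u v u' v'] pq D[of u v] D[of u' v'] by simp
  qed
  have disj: "?B \<inter> ?g ` ?D = {}"
  proof -
    have "map Suc u \<noteq> map Suc u' @ v'" if "motzkin u" "motzkin u'" "motzkin v'" for u u' v'
      using lift_append_inject[of u "[]" u' v'] that by (auto simp: motzkin_def)
    thus ?thesis by (auto dest!: M)
  qed
  have disj': "?A \<inter> (?B \<union> ?g ` ?D) = {}"
    using ne by auto
  have "(\<Sum>w\<in>motzkin_words (Suc n). f w) = sum f ?A + (sum f ?B + sum f (?g ` ?D))"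
  proof -
    have "sum f (?A \<union> (?B \<union> ?g ` ?D)) = sum f ?A + sum f (?B \<union> ?g ` ?D)"
      by (intro sum.union_disjoint disj' finite_UnI finite_imageI fin) auto
    also have "sum f (?B \<union> ?g ` ?D) = sum f ?B + sum f (?g ` ?D)"
      by (intro sum.union_disjoint disj finite_imageI fin) auto
    finally show ?thesis unfolding motzkin_words_Suc Un_assoc .
  qed
  also have "sum f ?B = (\<Sum>u\<in>motzkin_words n. f (1 # map Suc u))"
    by (subst sum.reindex) (auto simp: inj_on_def)
  also have "sum f (?g ` ?D) = (\<Sum>(u, v)\<in>?D. f (1 # map Suc u @ v))"
    by (subst sum.reindex[OF inj]) (simp add: case_prod_unfold)
  also have "\<dots> = (\<Sum>i\<le>n. \<Sum>(u, v)\<in>motzkin_words i \<times> motzkin_words (n - i). f (1 # map Suc u @ v))"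
  proof (rule sum.UNION_disjoint)
    show "\<forall>i\<in>{..n}. \<forall>j\<in>{..n}. i \<noteq> j \<longrightarrow>
        motzkin_words i \<times> motzkin_words (n - i) \<inter> motzkin_words j \<times> motzkin_words (n - j) = {}"
      by (auto simp: motzkin_words_eq)
  qed auto
  also have "\<dots> = (\<Sum>i\<le>n. \<Sum>u\<in>motzkin_words i. \<Sum>v\<in>motzkin_words (n - i). f (1 # map Suc u @ v))"
    by (simp add: sum.cartesian_product)
  finally show ?thesis by (simp add: add.assoc)
qed

lemma rise_map_Suc: "rise (Suc a) (map Suc u) = rise a u"
  by (induction u arbitrary: a) auto

lemma rise_append: "rise a (u @ v) = rise a u + rise (last (a # u)) v"
  by (induction u arbitrary: a) auto

lemma sper_eq: "motzkin w \<Longrightarrow> sper w = real (length w + rise 0 w)"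
  unfolding sper_def by (subst perimeter_polyomino) (auto dest: motzkin_pos)

lemma sper_one: "sper [1] = 2"
  by (subst sper_eq) (auto simp: motzkin_def)

lemma sper_lift: "motzkin u \<Longrightarrow> sper (1 # map Suc u) = sper u + 2"
  using sper_eq[OF motzkin_lift, of u] rise_map_Suc[of 0 u] by (simp add: sper_eq)

text \<open>
  The raised word ends at a height at which the step down to the initial 1 of \<open>v\<close> is not a rise,
  whereas \<open>v\<close> on its own starts with a rise from 0 to 1. This lost unit cancels one of the two
  units that the letter 1 in front contributes, one to the length and one to the rise.
\<close>

lemma sper_lift_append:
  assumes "motzkin u" "motzkin v"
  shows "sper (1 # map Suc u @ v) = sper u + sper v + 1"
proof -
  obtain v' where v: "v = 1 # v'" using assms(2) by (cases v) (auto simp: motzkin_def)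
  have "last (1 # map Suc u) \<ge> 1" by (auto simp: last_map)
  hence "rise (last (1 # map Suc u)) v + 1 = rise 0 v" by (simp add: v)
  thus ?thesis
    using sper_eq[OF motzkin_lift_append[OF assms]] rise_map_Suc[of 0 u] assms
    by (simp add: sper_eq rise_append)
qed

section \<open>Generating functions\<close>

definition motzkin_fps :: "real fps" where
  "motzkin_fps = Abs_fps (\<lambda>n. real (card (motzkin_words n)))"

definition sper_fps :: "real fps" where "sper_fps = Abs_fps total_sper"

text \<open>
  The three summands count the words of the forms \<open>1\<close>, \<open>1 u\<^sup>+\<close> and \<open>1 u\<^sup>+ v\<close>.
\<close>

lemma motzkin_fps_eq: "motzkin_fps = fps_X * (1 + motzkin_fps + motzkin_fps\<^sup>2)"
proof (rule fps_ext)
  fix n show "motzkin_fps $ n = (fps_X * (1 + motzkin_fps + motzkin_fps\<^sup>2)) $ n"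
  proof (cases n)
    case (Suc m)
    show ?thesis using sum_motzkin_words_Suc[of "\<lambda>_. 1 :: real" m]
      unfolding Suc fps_X_mult_nth power2_eq_square
      by (simp add: motzkin_fps_def fps_mult_nth atMost_atLeast0)
  qed (simp add: motzkin_fps_def motzkin_words_0)
qed

text \<open>
  Summing \<open>sper u + 2\<close> over \<open>u\<close> gives \<open>S + 2 M\<close>, and summing \<open>sper u + sper v + 1\<close> over pairs gives
  \<open>2 M S + M\<^sup>2\<close>.
\<close>

lemma sper_fps_eq: "sper_fps = fps_X * (2 + sper_fps + 2 * motzkin_fps + 2 * motzkin_fps * sper_fps + motzkin_fps\<^sup>2)"
proof (rule fps_ext)
  fix n show "sper_fps $ n = (fps_X * (2 + sper_fps + 2 * motzkin_fps + 2 * motzkin_fps * sper_fps + motzkin_fps\<^sup>2)) $ n"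
  proof (cases n)
    case (Suc m)
    have M: "motzkin w" if "w \<in> motzkin_words k" for w k using that by (simp add: motzkin_words_eq)
    let ?c = "\<lambda>k. real (card (motzkin_words k))"
    have "total_sper (Suc m) = (if m = 0 then 2 else 0) +
        (\<Sum>u\<in>motzkin_words m. sper u + 2) +
        (\<Sum>i\<le>m. \<Sum>u\<in>motzkin_words i. \<Sum>v\<in>motzkin_words (m - i). sper u + sper v + 1)"
      unfolding total_sper_def sum_motzkin_words_Suc
      by (simp add: sper_one[simplified] sper_lift[OF M, simplified] sper_lift_append[OF M M, simplified])
    also have "\<dots> = (if m = 0 then 2 else 0) + (total_sper m + 2 * ?c m) +
        (\<Sum>i\<le>m. total_sper i * ?c (m - i) + ?c i * total_sper (m - i) + ?c i * ?c (m - i))"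
      by (simp add: total_sper_def sum.distrib sum_distrib_left sum_distrib_right algebra_simps)
    also have "\<dots> = (2 + sper_fps + fps_const 2 * motzkin_fps + (sper_fps * motzkin_fps + motzkin_fps * sper_fps + motzkin_fps * motzkin_fps)) $ m"
      unfolding fps_add_nth fps_mult_left_const_nth
      by (simp add: sper_fps_def motzkin_fps_def fps_mult_nth atMost_atLeast0 sum.distrib fps_numeral_nth)
    also have "2 + sper_fps + fps_const 2 * motzkin_fps + (sper_fps * motzkin_fps + motzkin_fps * sper_fps + motzkin_fps * motzkin_fps) =
       2 + sper_fps + 2 * motzkin_fps + 2 * motzkin_fps * sper_fps + motzkin_fps\<^sup>2"
      by (simp add: algebra_simps power2_eq_square flip: numeral_fps_const)
    finally show ?thesis by (simp add: Suc sper_fps_def)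
  qed (simp add: sper_fps_def total_sper_def motzkin_words_0)
qed

lemma fps_square_eqD:
  fixes f g :: "real fps"
  assumes "f\<^sup>2 = g\<^sup>2" "f $ 0 = 1" "g $ 0 = 1"
  shows "f = g"
proof -
  have "f \<noteq> - g"
  proof
    assume "f = - g"
    hence "f $ 0 = - g $ 0" by simp
    with assms show False by simp
  qed
  thus ?thesis using assms(1) by (simp add: power2_eq_iff)
qed

definition root_fps :: "real fps" where "root_fps = fps_sqrt (1 - 2 * fps_X - 3 * fps_X ^ 2)"

lemma root_fps_square: "root_fps\<^sup>2 = 1 - 2 * fps_X - 3 * fps_X ^ 2" and root_fps_0: "root_fps $ 0 = 1"
proof -
  show "root_fps\<^sup>2 = 1 - 2 * fps_X - 3 * fps_X ^ 2"
    unfolding root_fps_def fps_sqrt_def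
    using power_radical[of "1 - 2 * fps_X - 3 * fps_X ^ 2 :: real fps" root 1]
    by (simp add: numeral_2_eq_2)
  show "root_fps $ 0 = 1" by (simp add: root_fps_def fps_sqrt_def)
qed

text \<open>
  Completing the square in the quadratic equation for \<open>M\<close>; the constant term 1 selects the branch.
\<close>

lemma root_fps_conv_motzkin_fps: "root_fps = 1 - fps_X - 2 * fps_X * motzkin_fps"
proof (rule fps_square_eqD)
  have "(1 - fps_X - 2 * fps_X * motzkin_fps)\<^sup>2 =
      (1 - fps_X)\<^sup>2 + 4 * fps_X * (fps_X * (1 + motzkin_fps + motzkin_fps\<^sup>2) - motzkin_fps) - 4 * fps_X\<^sup>2"
    by algebra
  also have "\<dots> = root_fps\<^sup>2"
    unfolding motzkin_fps_eq[symmetric] root_fps_square by algebra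
  finally show "root_fps\<^sup>2 = (1 - fps_X - 2 * fps_X * motzkin_fps)\<^sup>2" ..
qed (auto simp: root_fps_0)

text \<open>
  The equation for \<open>S\<close> is \<open>(1 - x - 2 x M) S = x (2 + 2 M + M\<^sup>2)\<close>. Its left-hand side is \<open>R S\<close>, and
  \<open>M\<close> is eliminated from the right-hand side with the quadratic equation and with \<open>2 x M = 1 - x - R\<close>.
\<close>

lemma sper_fps_root_fps: "2 * fps_X * root_fps * sper_fps = 1 + fps_X\<^sup>2 - (1 + fps_X) * root_fps"
proof -
  have "root_fps * sper_fps = fps_X * (2 + 2 * motzkin_fps + motzkin_fps\<^sup>2)"
    using sper_fps_eq root_fps_conv_motzkin_fps by algebra
  moreover have "fps_X * motzkin_fps\<^sup>2 = motzkin_fps - fps_X - fps_X * motzkin_fps"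
    using motzkin_fps_eq by algebra
  ultimately show ?thesis using root_fps_conv_motzkin_fps root_fps_square by algebra
qed

section \<open>Asymptotics of the central trinomial coefficients\<close>

text \<open>
  This is the central binomial coefficient \<open>2 k choose k\<close> divided by \<open>4\<^bsup>k\<^esup>\<close>, that is the
  coefficient of \<open>x\<^bsup>k\<^esup>\<close> in \<open>(1 - x)\<^bsup>-1/2\<^esup>\<close>.
\<close>

definition cbin :: "nat \<Rightarrow> real" where "cbin k = (-1) ^ k * (- (1 / 2) gchoose k)"

lemma gbinomial_conv_cbin: "- (1 / 2) gchoose k = (-1) ^ k * cbin k"
  by (simp add: cbin_def flip: mult.assoc power_mult_distrib)

lemma cbin_0: "cbin 0 = 1"
  by (simp add: cbin_def)

lemma cbin_Suc: "cbin (Suc k) = cbin k * ((2 * real k + 1) / (2 * real k + 2))"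
proof -
  have "real (Suc k) * (- (1 / 2) gchoose Suc k) = (- 1 / 2 - real k) * (- (1 / 2) gchoose k)"
    using gbinomial_mult_1[of "- (1 / 2) :: real" k] by (simp add: algebra_simps)
  hence "- (1 / 2) gchoose Suc k = - ((2 * real k + 1) / (2 * real k + 2)) * (- (1 / 2) gchoose k)"
    by (simp add: field_simps)
  thus ?thesis by (simp add: cbin_def)
qed

lemma cbin_pos: "cbin k > 0"
  by (induction k) (auto simp: cbin_0 cbin_Suc intro!: mult_pos_pos divide_pos_pos)

lemma cbin_le_1: "cbin k \<le> 1"
proof (induction k)
  case (Suc k)
  have "cbin (Suc k) \<le> cbin k * 1"
    unfolding cbin_Suc using cbin_pos[of k] by (intro mult_left_mono) auto
  with Suc show ?case by simp
qed (simp add: cbin_0)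

text \<open>
  Consecutive quotients are at most 2. This crude bound suffices as a majorant below, because
  there it is damped by a factor \<open>3\<^bsup>-k\<^esup>\<close>.
\<close>

lemma cbin_le_power_2_mult: "cbin m \<le> 2 ^ k * cbin (m + k)"
proof (induction k)
  case (Suc k)
  have "cbin (m + k) * 1 \<le> cbin (m + k) * (2 * ((2 * real (m + k) + 1) / (2 * real (m + k) + 2)))"
    using cbin_pos[of "m + k"] by (intro mult_left_mono) (auto simp: field_simps)
  hence "cbin (m + k) \<le> 2 * cbin (m + Suc k)"
    by (simp only: cbin_Suc add_Suc_right mult_1_right mult.left_commute)
  have "cbin m \<le> 2 ^ k * cbin (m + k)"
    by (rule Suc)
  also have "\<dots> \<le> 2 ^ k * (2 * cbin (m + Suc k))"
    using \<open>cbin (m + k) \<le> 2 * cbin (m + Suc k)\<close> by (intro mult_left_mono) auto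
  finally show ?case by (simp add: mult_ac)
qed simp

lemma cbin_limit: "(\<lambda>n. cbin n * sqrt (real n)) \<longlonglongrightarrow> 1 / sqrt pi"
proof -
  have "(\<lambda>n. (- (1 / 2) gchoose n) / ((-1) ^ n / exp ((- (1 / 2) + 1) * of_real (ln (real n)))) :: real)
          \<longlonglongrightarrow> inverse (Gamma (- (- (1 / 2))))"
    by (rule gbinomial_asymptotic)
  moreover have "eventually (\<lambda>n. (- (1 / 2) gchoose n) / ((-1) ^ n / exp ((- (1 / 2) + 1) * of_real (ln (real n))))
           = cbin n * sqrt (real n)) at_top"
    using eventually_gt_at_top[of 0]
  proof eventually_elim
    case (elim n)
    have "exp ((- (1 / 2) + 1) * ln (real n)) = sqrt (real n)"
      using elim by (simp add: powr_half_sqrt[symmetric] powr_def)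
    thus ?case by (simp add: gbinomial_conv_cbin)
  qed
  ultimately have "(\<lambda>n. cbin n * sqrt (real n)) \<longlonglongrightarrow> inverse (Gamma (- (- (1 / 2))))"
    by (rule Lim_transform_eventually)
  thus ?thesis by (simp add: Gamma_one_half_real field_simps)
qed

lemma cbin_ratio_limit: "(\<lambda>n. cbin (n - k) / cbin n) \<longlonglongrightarrow> 1"
proof (rule LIMSEQ_offset)
  have "(\<lambda>n. (cbin n * sqrt (real n)) / (cbin (n + k) * sqrt (real (n + k))) * sqrt (real (n + k) / real n))
          \<longlonglongrightarrow> (1 / sqrt pi) / (1 / sqrt pi) * 1"
  proof (intro tendsto_mult tendsto_divide cbin_limit LIMSEQ_ignore_initial_segment[OF cbin_limit])
    show "(\<lambda>n. sqrt (real (n + k) / real n)) \<longlonglongrightarrow> 1" by real_asymp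
  qed auto
  moreover have "eventually (\<lambda>n. (cbin n * sqrt (real n)) / (cbin (n + k) * sqrt (real (n + k))) * sqrt (real (n + k) / real n)
      = cbin (n + k - k) / cbin (n + k)) at_top"
    using eventually_gt_at_top[of 0]
    by eventually_elim (auto simp: real_sqrt_divide)
  ultimately show "(\<lambda>n. cbin (n + k - k) / cbin (n + k)) \<longlonglongrightarrow> 1"
    by (auto elim: Lim_transform_eventually)
qed

text \<open>
  The central trinomial coefficients, written as the convolution of the coefficients of
  \<open>(1 + x)\<^bsup>-1/2\<^esup>\<close> and \<open>(1 - 3 x)\<^bsup>-1/2\<^esup>\<close>.
\<close>

definition trinomial :: "nat \<Rightarrow> real" where
  "trinomial n = (\<Sum>k\<le>n. (- (1 / 2) gchoose k) * (3 ^ (n - k) * cbin (n - k)))"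

text \<open>
  After division by \<open>3\<^bsup>n\<^esup> cbin n\<close> the \<open>k\<close>-th summand of \<open>trinomial n\<close> tends to
  \<open>(-1/2 gchoose k) (1/3)\<^bsup>k\<^esup>\<close> and is bounded by \<open>(2/3)\<^bsup>k\<^esup>\<close> uniformly in \<open>n\<close>. By Tannery's theorem limit and
  sum can be exchanged, and the binomial series at \<open>1/3\<close> sums to \<open>(4/3)\<^bsup>-1/2\<^esup> = sqrt 3 / 2\<close>.
\<close>

lemma trinomial_limit: "(\<lambda>n. trinomial n * sqrt (real n) / 3 ^ n) \<longlonglongrightarrow> sqrt 3 / (2 * sqrt pi)"
proof -
  \<comment> \<open>Extended by 0 beyond \<open>k = n\<close>, so that the finite convolution sums become series to which
    Tannery's theorem applies.\<close>
  define a where "a = (\<lambda>k n. if k \<le> n then (- (1 / 2) gchoose k) * (1 / 3) ^ k * (cbin (n - k) / cbin n) else 0)"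
  have "(\<lambda>n. \<Sum>k. a k n) \<longlonglongrightarrow> (\<Sum>k. (- (1 / 2) gchoose k) * (1 / 3) ^ k)"
  proof (rule tannerys_theorem[THEN conjunct2, THEN conjunct2])
    show "(\<lambda>n. a k n) \<longlonglongrightarrow> (- (1 / 2) gchoose k) * (1 / 3) ^ k" for k
    proof -
      have "(\<lambda>n. (- (1 / 2) gchoose k) * (1 / 3) ^ k * (cbin (n - k) / cbin n))
              \<longlonglongrightarrow> (- (1 / 2) gchoose k) * (1 / 3) ^ k * 1"
        by (intro tendsto_intros cbin_ratio_limit)
      moreover have "eventually (\<lambda>n. (- (1 / 2) gchoose k) * (1 / 3) ^ k * (cbin (n - k) / cbin n) = a k n) at_top"
        using eventually_ge_at_top[of k] by eventually_elim (simp add: a_def)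
      ultimately show ?thesis by (auto elim: Lim_transform_eventually)
    qed
    have "norm (a k n) \<le> (2 / 3) ^ k" for k n
    proof (cases "k \<le> n")
      case True
      have "norm (a k n) = cbin k * (1 / 3) ^ k * (cbin (n - k) / cbin n)"
        using True cbin_pos[of k] cbin_pos[of n] cbin_pos[of "n - k"]
        by (simp add: a_def gbinomial_conv_cbin abs_mult)
      also have "\<dots> \<le> 1 * (1 / 3) ^ k * 2 ^ k"
        using cbin_le_power_2_mult[of "n - k" k] True cbin_pos[of k] cbin_pos[of n] cbin_pos[of "n - k"] cbin_le_1[of k]
        by (intro mult_mono) (auto simp: field_simps intro: less_imp_le)
      finally show ?thesis by (simp add: power_divide)
    qed (simp add: a_def)
    thus "eventually (\<lambda>(k, n). norm (a k n) \<le> (2 / 3) ^ k) (at_top \<times>\<^sub>F sequentially)"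
      by (intro always_eventually) auto
  qed (auto intro: summable_geometric)
  also have "(\<Sum>k. (- (1 / 2) gchoose k) * (1 / 3) ^ k) = sqrt 3 / 2"
  proof -
    have "(\<lambda>k. (- (1 / 2) gchoose k) * (1 / 3) ^ k) sums (1 + 1 / 3 :: real) powr (- (1 / 2))"
      by (rule gen_binomial_real) auto
    also have "(1 + 1 / 3 :: real) powr (- (1 / 2)) = sqrt 3 / 2"
      by (simp add: powr_minus powr_half_sqrt real_sqrt_divide field_simps)
    finally show ?thesis by (simp add: sums_iff)
  qed
  finally have "(\<lambda>n. (\<Sum>k. a k n) * (cbin n * sqrt (real n))) \<longlonglongrightarrow> sqrt 3 / 2 * (1 / sqrt pi)"
    by (intro tendsto_mult cbin_limit)
  moreover have "(\<Sum>k. a k n) * (cbin n * sqrt (real n)) = trinomial n * sqrt (real n) / 3 ^ n" for n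
  proof -
    have "(\<Sum>k. a k n) = (\<Sum>k\<le>n. a k n)"
      by (rule suminf_finite) (auto simp: a_def)
    also have "\<dots> * (cbin n * sqrt (real n)) = (\<Sum>k\<le>n. (- (1 / 2) gchoose k) * (3 ^ (n - k) * cbin (n - k)) * (sqrt (real n) / 3 ^ n))"
      unfolding sum_distrib_right using cbin_pos[of n]
      by (intro sum.cong) (auto simp: a_def power_diff field_simps)
    also have "\<dots> = trinomial n * sqrt (real n) / 3 ^ n"
      by (simp add: trinomial_def sum_distrib_right sum_divide_distrib)
    finally show ?thesis .
  qed
  ultimately show ?thesis by simp
qed

definition trinomial_fps :: "real fps" where "trinomial_fps = Abs_fps trinomial"

lemma fps_binomial_half_square: "(fps_binomial (- (1 / 2) :: real))\<^sup>2 * (1 + fps_X) = 1"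
proof -
  have "(fps_binomial (- (1 / 2) :: real))\<^sup>2 = fps_binomial (- 1)"
    by (simp add: fps_binomial_power)
  thus ?thesis by (simp add: fps_binomial_minus_one inverse_mult_eq_1)
qed

text \<open>
  Both factors of \<open>1 - 2 x - 3 x\<^sup>2 = (1 + x) (1 - 3 x)\<close> have an explicit inverse square root: the
  binomial series with exponent \<open>-1/2\<close>, for the second factor with \<open>x\<close> replaced by \<open>-3 x\<close>.
\<close>

lemma trinomial_fps_square: "trinomial_fps\<^sup>2 * (1 - 2 * fps_X - 3 * fps_X\<^sup>2) = 1"
proof -
  let ?B = "fps_binomial (- (1 / 2) :: real)"
  let ?B3 = "?B oo (fps_const (-3) * fps_X)"
  have B3: "?B3\<^sup>2 * (1 - 3 * fps_X) = 1"
  proof -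
    have "(?B\<^sup>2 * (1 + fps_X)) oo (fps_const (-3) * fps_X) = 1"
      by (simp only: fps_binomial_half_square) simp
    also have "(?B\<^sup>2 * (1 + fps_X)) oo (fps_const (-3) * fps_X) = ?B3\<^sup>2 * (1 + fps_const (-3) * fps_X)"
      by (simp add: fps_compose_mult_distrib fps_compose_power fps_compose_add_distrib)
    also have "1 + fps_const (-3) * fps_X = (1 - 3 * fps_X :: real fps)"
      by (simp add: numeral_fps_const flip: fps_const_neg)
    finally show ?thesis .
  qed
  have "trinomial_fps = ?B * ?B3"
  proof (rule fps_ext)
    fix n
    have "?B3 $ m = 3 ^ m * cbin m" for m
      unfolding fps_nth_compose_linear fps_binomial_nth gbinomial_conv_cbin
      by (simp flip: mult.assoc power_mult_distrib)
    thus "trinomial_fps $ n = (?B * ?B3) $ n"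
      by (simp add: trinomial_fps_def trinomial_def fps_mult_nth atMost_atLeast0)
  qed
  hence "trinomial_fps\<^sup>2 * (1 - 2 * fps_X - 3 * fps_X\<^sup>2) = (?B\<^sup>2 * (1 + fps_X)) * (?B3\<^sup>2 * (1 - 3 * fps_X))"
    by algebra
  thus ?thesis by (simp only: B3 fps_binomial_half_square mult_1_left)
qed

text \<open>
  With \<open>c(n) \<sim> L 3\<^bsup>n\<^esup> / sqrt n\<close>, the neighbours \<open>c(n + 1)\<close> and \<open>c(n - 1)\<close> contribute the factors \<open>3\<close> and
  \<open>1/3\<close>. The limit is taken at \<open>n + 1\<close> in place of \<open>n\<close> to avoid truncated subtraction.
\<close>

lemma asymp_equiv_of_trinomial_sum:
  assumes s: "\<And>n. n \<ge> 1 \<Longrightarrow> 2 * s n = trinomial (n + 1) + trinomial (n - 1)"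
  shows "s \<sim>[sequentially] (\<lambda>n. 5 * sqrt 3 * sqrt (1 / real n) * 3 ^ n / (6 * sqrt pi))"
proof -
  let ?L = "sqrt 3 / (2 * sqrt pi)"
  let ?t = "\<lambda>n. trinomial n * sqrt (real n) / 3 ^ n"
  have "(\<lambda>n. 3 * (?t (n + 2) * sqrt (real (n + 1) / real (n + 2))) +
             1 / 3 * (?t n * sqrt (real (n + 1) / real n)))
          \<longlonglongrightarrow> 3 * (?L * 1) + 1 / 3 * (?L * 1)"
    (is "?f \<longlonglongrightarrow> _")
  proof (intro tendsto_add tendsto_mult tendsto_const trinomial_limit LIMSEQ_ignore_initial_segment[OF trinomial_limit])
    show "(\<lambda>n. sqrt (real (n + 1) / real (n + 2))) \<longlonglongrightarrow> 1" by real_asymp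
    show "(\<lambda>n. sqrt (real (n + 1) / real n)) \<longlonglongrightarrow> 1" by real_asymp
  qed
  moreover have "eventually (\<lambda>n. ?f n = 2 * s (n + 1) * sqrt (real (n + 1)) / 3 ^ (n + 1)) sequentially"
    using eventually_gt_at_top[of 0]
  proof eventually_elim
    case (elim n)
    have "3 * (?t (n + 2) * sqrt (real (n + 1) / real (n + 2))) = trinomial (n + 2) * sqrt (real (n + 1)) / 3 ^ (n + 1)"
      by (simp add: real_sqrt_divide)
    moreover have "1 / 3 * (?t n * sqrt (real (n + 1) / real n)) = trinomial n * sqrt (real (n + 1)) / 3 ^ (n + 1)"
      using elim by (simp add: real_sqrt_divide)
    ultimately have "?f n = (trinomial (n + 2) + trinomial n) * sqrt (real (n + 1)) / 3 ^ (n + 1)"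
      by (simp only: add_divide_distrib distrib_right)
    also have "trinomial (n + 2) + trinomial n = 2 * s (n + 1)" using s[of "n + 1"] by simp
    finally show ?case .
  qed
  ultimately have "(\<lambda>n. 2 * s (n + 1) * sqrt (real (n + 1)) / 3 ^ (n + 1)) \<longlonglongrightarrow> 3 * (?L * 1) + 1 / 3 * (?L * 1)"
    by (rule Lim_transform_eventually)
  hence "(\<lambda>n. 2 * s n * sqrt (real n) / 3 ^ n) \<longlonglongrightarrow> 3 * (?L * 1) + 1 / 3 * (?L * 1)"
    by (rule LIMSEQ_offset[where k = 1])
  hence "(\<lambda>n. 2 * s n * sqrt (real n) / 3 ^ n * (3 * sqrt pi / (5 * sqrt 3))) \<longlonglongrightarrow>
     (3 * (?L * 1) + 1 / 3 * (?L * 1)) * (3 * sqrt pi / (5 * sqrt 3))"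
    by (rule tendsto_mult) simp
  also have "(3 * (?L * 1) + 1 / 3 * (?L * 1)) * (3 * sqrt pi / (5 * sqrt 3)) = 1"
    by (simp add: field_simps)
  also have "(\<lambda>n. 2 * s n * sqrt (real n) / 3 ^ n * (3 * sqrt pi / (5 * sqrt 3))) =
     (\<lambda>n. s n / (5 * sqrt 3 * sqrt (1 / real n) * 3 ^ n / (6 * sqrt pi)))"
    by (simp add: fun_eq_iff real_sqrt_divide field_simps)
  finally show ?thesis by (intro asymp_equivI')
qed

section \<open>Closed form and asymptotics of the total semiperimeter\<close>

lemma root_fps_mult_trinomial_fps: "root_fps * trinomial_fps = 1"
proof (rule fps_square_eqD)
  show "(root_fps * trinomial_fps)\<^sup>2 = 1\<^sup>2"
    using trinomial_fps_square by (simp add: power_mult_distrib root_fps_square mult.commute)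
qed (simp_all add: root_fps_0 trinomial_fps_def trinomial_def cbin_0)

text \<open>
  The polynomial \<open>1 + x\<close> in \<open>2 x S = (1 + x\<^sup>2) / R - (1 + x)\<close> does not reach the coefficients of
  \<open>x\<^bsup>n + 1\<^esup>\<close> with \<open>n \<ge> 1\<close>.
\<close>

lemma total_sper_conv_trinomial:
  assumes "n \<ge> 1"
  shows "2 * total_sper n = trinomial (n + 1) + trinomial (n - 1)"
proof -
  have "fps_X * (fps_const 2 * sper_fps) = (2 * fps_X * root_fps * sper_fps) * trinomial_fps"
    using root_fps_mult_trinomial_fps unfolding numeral_fps_const[symmetric] by algebra
  also have "\<dots> = trinomial_fps + fps_X * (fps_X * trinomial_fps) - (1 + fps_X)"
    unfolding sper_fps_root_fps using root_fps_mult_trinomial_fps by algebra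
  finally have "(fps_X * (fps_const 2 * sper_fps)) $ (n + 1) =
      (trinomial_fps + fps_X * (fps_X * trinomial_fps) - (1 + fps_X)) $ (n + 1)"
    by (rule arg_cong)
  thus ?thesis
    using assms by (simp add: sper_fps_def trinomial_fps_def fps_X_nth)
qed

theorem corollary4p4:
  fixes X R :: "real fls"
  defines "X \<equiv> fls_X"
    and "R \<equiv> fps_to_fls (fps_sqrt (1 - 2 * fps_X - 3 * fps_X ^ 2))"
  shows "fps_to_fls (Abs_fps (\<lambda>n. if n \<ge> 1 then total_sper n else 0)) =
           (1 + X ^ 2 - (1 + X) * R) / (2 * X * R) \<and>
         total_sper \<sim>[sequentially]
           (\<lambda>n. 5 * sqrt 3 * sqrt (1 / real n) * 3 ^ n / (6 * sqrt pi))"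
proof
  have R: "R = fps_to_fls root_fps" and X: "X = fps_to_fls fps_X"
    by (simp_all add: R_def root_fps_def X_def)
  have "Abs_fps (\<lambda>n. if n \<ge> 1 then total_sper n else 0) = sper_fps"
    by (auto simp: fps_eq_iff sper_fps_def total_sper_def motzkin_words_0 not_le)
  moreover have "root_fps \<noteq> 0"
    using root_fps_mult_trinomial_fps by auto
  moreover have "fps_to_fls sper_fps * (2 * X * R) = 1 + X ^ 2 - (1 + X) * R"
  proof -
    have "fps_to_fls (2 * fps_X * root_fps * sper_fps) = fps_to_fls (1 + fps_X\<^sup>2 - (1 + fps_X) * root_fps)"
      by (simp only: sper_fps_root_fps)
    thus ?thesis
      unfolding R X by (simp add: fls_times_fps_to_fls fps_to_fls_power mult_ac)
  qed
  ultimately show "fps_to_fls (Abs_fps (\<lambda>n. if n \<ge> 1 then total_sper n else 0)) =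
      (1 + X ^ 2 - (1 + X) * R) / (2 * X * R)"
    by (simp add: eq_divide_eq R X)
  show "total_sper \<sim>[sequentially]
      (\<lambda>n. 5 * sqrt 3 * sqrt (1 / real n) * 3 ^ n / (6 * sqrt pi))"
    by (rule asymp_equiv_of_trinomial_sum) (rule total_sper_conv_trinomial)
qed

end
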